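(* Let $L_0$ be a (nonempty) lattice with the following properties: the principal filter $\operatorname{fil}(x)$ is finite for each $x\in L_0$; $L_0\in\mathbf{SD}_\vee(n)$ for some $n<\omega$; and $L_0$ is lower semimodular. Then the filter lattice $L=\operatorname{Fil}(L_0)$ is a strongly coatomic, lower continuous convex geometry.
   Context: $\operatorname{fil}(x)=\{y\in L_0:y\geq x\}$. $\operatorname{Fil}(L_0)$ is the lattice of all nonempty filters of $L_0$, ordered by reverse inclusion: $F\leq G$ iff $F\supseteq G$. Define lattice terms in $x,y,z$ recursively by $y_0=y$, $z_0=z$, and $y_{k+1}=y\wedge(x\vee z_k)$, $z_{k+1}=z\wedge(x\vee y_k)$ for $k\geq 0$. $\mathbf{SD}_\vee(n)$ is the variety of all lattices satisfying the inclusion $y_n\leq x\vee(y\wedge z)$ for all $x,y,z$. Write $a\prec b$ if $b$ covers $a$. A lattice is lower semimodular if $a\prec b$ implies $a\wedge c\prec b\wedge c$ or $a\wedge c=b\wedge c$, for all $a,b,c$. A lattice is strongly coatomic if whenever $a<c$ there exists $b$ with $a\leq b\prec c$. A complete lattice is lower continuous if $a\vee\bigwedge D=\bigwedge_{d\in D}(a\vee d)$ for every element $a$ and every (nonempty) down-directed subset $D$, where $D$ is down-directed if any $d_1,d_2\in D$ have a common lower bound $d_3\in D$. A closure system $(X,\gamma)$ (a set $X$ with a closure operator $\gamma$ on its subsets) has the anti-exchange property if for all $x\neq y$ in $X$ and all closed $A\subseteq X$: $x\in\gamma(A\cup\{y\})$ and $x\notin A$ imply $y\notin\gamma(A\cup\{x\})$.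 A convex geometry is a closure system with $\gamma(\emptyset)=\emptyset$ that has the anti-exchange property. Saying that a lattice $L$ "is a strongly coatomic, lower continuous convex geometry" means that $L$ is a complete lattice that is strongly coatomic and lower continuous, and is isomorphic to the lattice of closed sets (ordered by inclusion) of some convex geometry. *)

theory Defs
  imports "HOL-Algebra.Complete_Lattice"
begin

section \<open>Filters\<close>

definition fil :: "('a, 'b) gorder_scheme \<Rightarrow> 'a \<Rightarrow> 'a set"
  where "fil L x = {y \<in> carrier L. x \<sqsubseteq>\<^bsub>L\<^esub> y}"

definition is_filter :: "('a, 'b) gorder_scheme \<Rightarrow> 'a set \<Rightarrow> bool"
  where "is_filter L F \<longleftrightarrow> F \<subseteq> carrier L \<and>
    (\<forall>x\<in>F. \<forall>y\<in>carrier L. x \<sqsubseteq>\<^bsub>L\<^esub> y \<longrightarrow> y \<in> F) \<and>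
    (\<forall>x\<in>F. \<forall>y\<in>F. x \<sqinter>\<^bsub>L\<^esub> y \<in> F)"

definition Fil :: "('a, 'b) gorder_scheme \<Rightarrow> 'a set gorder"
  where "Fil L = \<lparr>carrier = {F. is_filter L F \<and> F \<noteq> {}}, eq = (=), le = (\<lambda>F G. F \<supseteq> G)\<rparr>"


section \<open>The varieties \<open>SD\<^sub>\<or>(n)\<close>\<close>

fun y_term :: "('a, 'b) gorder_scheme \<Rightarrow> nat \<Rightarrow> 'a \<Rightarrow> 'a \<Rightarrow> 'a \<Rightarrow> 'a"
  and z_term :: "('a, 'b) gorder_scheme \<Rightarrow> nat \<Rightarrow> 'a \<Rightarrow> 'a \<Rightarrow> 'a \<Rightarrow> 'a"
  where
    "y_term L 0 x y z = y"
  | "y_term L (Suc k) x y z = y \<sqinter>\<^bsub>L\<^esub> (x \<squnion>\<^bsub>L\<^esub> z_term L k x y z)"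
  | "z_term L 0 x y z = z"
  | "z_term L (Suc k) x y z = z \<sqinter>\<^bsub>L\<^esub> (x \<squnion>\<^bsub>L\<^esub> y_term L k x y z)"

definition SD_join :: "nat \<Rightarrow> ('a, 'b) gorder_scheme \<Rightarrow> bool"
  where "SD_join n L \<longleftrightarrow> lattice L \<and>
    (\<forall>x\<in>carrier L. \<forall>y\<in>carrier L. \<forall>z\<in>carrier L.
       y_term L n x y z \<sqsubseteq>\<^bsub>L\<^esub> x \<squnion>\<^bsub>L\<^esub> (y \<sqinter>\<^bsub>L\<^esub> z))"


section \<open>Covers, lower semimodularity, strong coatomicity, lower continuity\<close>

definition covered_by :: "('a, 'b) gorder_scheme \<Rightarrow> 'a \<Rightarrow> 'a \<Rightarrow> bool"
  where "covered_by L a b \<longleftrightarrow> a \<in> carrier L \<and> b \<in> carrier L \<and> a \<sqsubset>\<^bsub>L\<^esub> b \<and>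
    \<not> (\<exists>c\<in>carrier L. a \<sqsubset>\<^bsub>L\<^esub> c \<and> c \<sqsubset>\<^bsub>L\<^esub> b)"

definition lower_semimodular :: "('a, 'b) gorder_scheme \<Rightarrow> bool"
  where "lower_semimodular L \<longleftrightarrow> lattice L \<and>
    (\<forall>a\<in>carrier L. \<forall>b\<in>carrier L. \<forall>c\<in>carrier L. covered_by L a b \<longrightarrow>
       covered_by L (a \<sqinter>\<^bsub>L\<^esub> c) (b \<sqinter>\<^bsub>L\<^esub> c) \<or> a \<sqinter>\<^bsub>L\<^esub> c = b \<sqinter>\<^bsub>L\<^esub> c)"

definition strongly_coatomic :: "('a, 'b) gorder_scheme \<Rightarrow> bool"
  where "strongly_coatomic L \<longleftrightarrow> lattice L \<and>
    (\<forall>a\<in>carrier L. \<forall>c\<in>carrier L. a \<sqsubset>\<^bsub>L\<^esub> c \<longrightarrow>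
       (\<exists>b\<in>carrier L. a \<sqsubseteq>\<^bsub>L\<^esub> b \<and> covered_by L b c))"

definition down_directed :: "('a, 'b) gorder_scheme \<Rightarrow> 'a set \<Rightarrow> bool"
  where "down_directed L D \<longleftrightarrow> D \<subseteq> carrier L \<and> D \<noteq> {} \<and>
    (\<forall>d\<^sub>1\<in>D. \<forall>d\<^sub>2\<in>D. \<exists>d\<^sub>3\<in>D. d\<^sub>3 \<sqsubseteq>\<^bsub>L\<^esub> d\<^sub>1 \<and> d\<^sub>3 \<sqsubseteq>\<^bsub>L\<^esub> d\<^sub>2)"

definition lower_continuous :: "('a, 'b) gorder_scheme \<Rightarrow> bool"
  where "lower_continuous L \<longleftrightarrow> complete_lattice L \<and>
    (\<forall>a\<in>carrier L. \<forall>D. down_directed L D \<longrightarrow>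
       a \<squnion>\<^bsub>L\<^esub> (\<Sqinter>\<^bsub>L\<^esub> D) = \<Sqinter>\<^bsub>L\<^esub> ((\<lambda>d. a \<squnion>\<^bsub>L\<^esub> d) ` D))"


section \<open>Convex geometries\<close>

locale closure_system =
  fixes X :: "'a set" and \<gamma> :: "'a set \<Rightarrow> 'a set"
  assumes closure_subset: "A \<subseteq> X \<Longrightarrow> \<gamma> A \<subseteq> X"
    and extensive: "A \<subseteq> X \<Longrightarrow> A \<subseteq> \<gamma> A"
    and monotone: "A \<subseteq> B \<Longrightarrow> B \<subseteq> X \<Longrightarrow> \<gamma> A \<subseteq> \<gamma> B"
    and idem: "A \<subseteq> X \<Longrightarrow> \<gamma> (\<gamma> A) = \<gamma> A"

definition closed_sets :: "'a set \<Rightarrow> ('a set \<Rightarrow> 'a set) \<Rightarrow> 'a set set"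
  where "closed_sets X \<gamma> = {A. A \<subseteq> X \<and> \<gamma> A = A}"

definition closed_set_lattice :: "'a set \<Rightarrow> ('a set \<Rightarrow> 'a set) \<Rightarrow> 'a set gorder"
  where "closed_set_lattice X \<gamma> = \<lparr>carrier = closed_sets X \<gamma>, eq = (=), le = (\<subseteq>)\<rparr>"

locale convex_geometry = closure_system +
  assumes closure_empty: "\<gamma> {} = {}"
    and anti_exchange:
      "\<lbrakk>x \<in> X; y \<in> X; x \<noteq> y; A \<in> closed_sets X \<gamma>; x \<in> \<gamma> (A \<union> {y}); x \<notin> A\<rbrakk>
        \<Longrightarrow> y \<notin> \<gamma> (A \<union> {x})"

definition order_isomorphic :: "('a, 'c) gorder_scheme \<Rightarrow> ('b, 'd) gorder_scheme \<Rightarrow> bool"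
  where "order_isomorphic L M \<longleftrightarrow>
    (\<exists>f. bij_betw f (carrier L) (carrier M) \<and> order_emb L M f)"

text \<open>
  The points of the geometry are taken from the type of the elements of the lattice.  This is no
  restriction: in a convex geometry the closures of single points are pairwise distinct closed
  sets, so the points can always be renamed to lattice elements; see
  \<open>is_convex_geometry_latticeI\<close> below.
\<close>

definition is_convex_geometry_lattice :: "('a, 'b) gorder_scheme \<Rightarrow> bool"
  where "is_convex_geometry_lattice L \<longleftrightarrow>
    (\<exists>(X :: 'a set) \<gamma>. convex_geometry X \<gamma> \<and> order_isomorphic L (closed_set_lattice X \<gamma>))"

lemma closed_set_lattice_partial_order: "partial_order (closed_set_lattice X \<gamma>)"
  by unfold_locales (auto simp: closed_set_lattice_def)

context convex_geometry
begin

lemma singleton_closures_inj: "inj_on (\<lambda>x. \<gamma> {x}) X"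
proof (rule inj_onI, rule ccontr)
  fix x y assume xy: "x \<in> X" "y \<in> X" "\<gamma> {x} = \<gamma> {y}" "x \<noteq> y"
  have "{} \<in> closed_sets X \<gamma>" by (simp add: closed_sets_def closure_empty)
  moreover have "x \<in> \<gamma> {y}" "y \<in> \<gamma> {x}"
    using xy extensive[of "{x}"] extensive[of "{y}"] by auto
  ultimately show False using anti_exchange[of x y "{}"] xy by simp
qed

context
  fixes \<phi> :: "'a \<Rightarrow> 'b" and \<delta> :: "'b set \<Rightarrow> 'b set"
  assumes inj: "inj_on \<phi> X"
  defines "\<delta> \<equiv> \<lambda>B. \<phi> ` \<gamma> (\<phi> -` B \<inter> X)"
begin

lemma vimage_image: "A \<subseteq> X \<Longrightarrow> \<phi> -` (\<phi> ` A) \<inter> X = A"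
  using inj by (auto dest: inj_onD)

lemma renamed_closure: "A \<subseteq> X \<Longrightarrow> \<delta> (\<phi> ` A) = \<phi> ` \<gamma> A"
  by (simp add: \<delta>_def vimage_image)

lemma renamed_closed_sets: "closed_sets (\<phi> ` X) \<delta> = (\<lambda>A. \<phi> ` A) ` closed_sets X \<gamma>"
proof
  show "closed_sets (\<phi> ` X) \<delta> \<subseteq> (\<lambda>A. \<phi> ` A) ` closed_sets X \<gamma>"
  proof
    fix B assume B: "B \<in> closed_sets (\<phi> ` X) \<delta>"
    then obtain A where A: "A \<subseteq> X" "B = \<phi> ` A"
      by (auto simp: closed_sets_def subset_image_iff)
    then have "\<phi> ` \<gamma> A = \<phi> ` A" using B renamed_closure by (simp add: closed_sets_def)
    then have "\<gamma> A = A" using A(1) inj closure_subset by (simp add: inj_on_image_eq_iff)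
    then show "B \<in> (\<lambda>A. \<phi> ` A) ` closed_sets X \<gamma>" using A by (auto simp: closed_sets_def)
  qed
  show "(\<lambda>A. \<phi> ` A) ` closed_sets X \<gamma> \<subseteq> closed_sets (\<phi> ` X) \<delta>"
    by (auto simp: closed_sets_def renamed_closure)
qed

lemma renamed_convex_geometry: "convex_geometry (\<phi> ` X) \<delta>"
proof
  fix A assume "A \<subseteq> \<phi> ` X"
  then obtain A' where A': "A' \<subseteq> X" "A = \<phi> ` A'" by (auto simp: subset_image_iff)
  show "\<delta> A \<subseteq> \<phi> ` X" "A \<subseteq> \<delta> A" "\<delta> (\<delta> A) = \<delta> A"
    using A' closure_subset[of A'] extensive[of A'] idem[of A']
    by (auto simp: renamed_closure)
next
  fix A B assume "A \<subseteq> B" "B \<subseteq> \<phi> ` X"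
  then show "\<delta> A \<subseteq> \<delta> B"
    unfolding \<delta>_def by (intro image_mono monotone) auto
next
  show "\<delta> {} = {}" using renamed_closure[of "{}"] by (simp add: closure_empty)
next
  fix x y A
  assume "x \<in> \<phi> ` X" "y \<in> \<phi> ` X" "x \<noteq> y" "A \<in> closed_sets (\<phi> ` X) \<delta>"
    and xA: "x \<in> \<delta> (A \<union> {y})" "x \<notin> A"
  then obtain x' y' A' where *: "x' \<in> X" "x = \<phi> x'" "y' \<in> X" "y = \<phi> y'" "x' \<noteq> y'"
    "A' \<in> closed_sets X \<gamma>" "A = \<phi> ` A'"
    by (auto simp: renamed_closed_sets)
  have sub: "A' \<subseteq> X" using * by (simp add: closed_sets_def)
  have mem: "\<phi> u \<in> \<delta> (A \<union> {\<phi> v}) \<longleftrightarrow> u \<in> \<gamma> (A' \<union> {v})" if "u \<in> X" "v \<in> X" for u v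
  proof -
    have "A' \<union> {v} \<subseteq> X" using sub that by simp
    moreover have "A \<union> {\<phi> v} = \<phi> ` (A' \<union> {v})" using * by simp
    ultimately have "\<delta> (A \<union> {\<phi> v}) = \<phi> ` \<gamma> (A' \<union> {v})" "\<gamma> (A' \<union> {v}) \<subseteq> X"
      using renamed_closure closure_subset by metis+
    then show ?thesis using that inj by (simp add: inj_on_image_mem_iff)
  qed
  have "x' \<in> \<gamma> (A' \<union> {y'})" "x' \<notin> A'" using xA * mem by auto
  then have "y' \<notin> \<gamma> (A' \<union> {x'})" using anti_exchange * by blast
  then show "y \<notin> \<delta> (A \<union> {x})" using mem * by simp
qed

lemma renamed_order_emb:
  "order_emb (closed_set_lattice X \<gamma>) (closed_set_lattice (\<phi> ` X) \<delta>) (\<lambda>A. \<phi> ` A)"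
proof -
  have "\<phi> ` A \<subseteq> \<phi> ` B \<longleftrightarrow> A \<subseteq> B" if "A \<subseteq> X" "B \<subseteq> X" for A B
    using vimage_image[OF that(1)] vimage_image[OF that(2)] by blast
  then show ?thesis
    using closed_set_lattice_partial_order[THEN partial_order.axioms(1), of X \<gamma>]
      closed_set_lattice_partial_order[THEN partial_order.axioms(1), of "\<phi> ` X" \<delta>]
    by (auto simp: order_emb_def closed_set_lattice_def closed_sets_def)
qed

lemma renamed_bij:
  "bij_betw (\<lambda>A. \<phi> ` A) (closed_sets X \<gamma>) (closed_sets (\<phi> ` X) \<delta>)"
  unfolding bij_betw_def renamed_closed_sets
  using inj by (auto simp: closed_sets_def intro!: inj_onI dest: inj_on_image_eq_iff)

end

end

lemma is_convex_geometry_latticeI: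
  fixes L :: "('a, 'b) gorder_scheme" and X :: "'c set"
  assumes "convex_geometry X \<gamma>" "order_isomorphic L (closed_set_lattice X \<gamma>)"
  shows "is_convex_geometry_lattice L"
proof -
  interpret convex_geometry X \<gamma> by fact
  obtain f where f: "bij_betw f (carrier L) (closed_sets X \<gamma>)"
    "order_emb L (closed_set_lattice X \<gamma>) f"
    using assms(2) by (auto simp: order_isomorphic_def closed_set_lattice_def)
  define \<phi> where "\<phi> = inv_into (carrier L) f \<circ> (\<lambda>x. \<gamma> {x})"
  have "(\<lambda>x. \<gamma> {x}) ` X \<subseteq> closed_sets X \<gamma>"
    using closure_subset idem by (auto simp: closed_sets_def)
  then have inj: "inj_on \<phi> X"
    unfolding \<phi>_def
    using f(1) by (intro comp_inj_on singleton_closures_inj inj_on_inv_into) (auto simp: bij_betw_def)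
  let ?\<delta> = "\<lambda>B. \<phi> ` \<gamma> (\<phi> -` B \<inter> X)"
  let ?g = "(\<lambda>A. \<phi> ` A) \<circ> f"
  have "bij_betw ?g (carrier L) (carrier (closed_set_lattice (\<phi> ` X) ?\<delta>))"
    using bij_betw_trans[OF f(1) renamed_bij[OF inj]] by (simp add: closed_set_lattice_def)
  moreover have "order_emb L (closed_set_lattice (\<phi> ` X) ?\<delta>) ?g"
    using f renamed_order_emb[OF inj] bij_betwE[OF f(1)]
    by (auto simp: order_emb_def closed_set_lattice_def)
  ultimately show ?thesis
    unfolding is_convex_geometry_lattice_def order_isomorphic_def
    using renamed_convex_geometry[OF inj] by blast
qed

end

theory Submission
  imports Defs
begin

text \<open>
  Throughout, ``larger filter'' refers to inclusion of sets, which is the reverse of the order of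
  \<open>Fil L\<close>: joins of \<open>Fil L\<close> are intersections, and the meet of a down-directed family is its
  union. Lower continuity is then just the distributivity of intersection over unions.
  
  The remaining two claims rest on one consequence of finiteness of principal filters. If a filter
  \<open>F\<close> is not contained in a filter \<open>G\<close>, then \<open>F - G\<close> has a maximal element \<open>f\<close>, and each upper cover
  \<open>g\<close> of \<open>f\<close> lies in \<open>G\<close> (\<open>critical_element\<close>). Lower semimodularity transports the cover \<open>f \<prec> g\<close>
  down to \<open>f \<sqinter> a \<prec> g \<sqinter> a\<close> for \<open>a \<in> G\<close>, and this forces every filter strictly larger than \<open>G\<close>
  but contained in the filter generated by \<open>G\<close> and \<open>f\<close> to contain \<open>f\<close>
  (\<open>adjoin_lower_cover_minimal\<close>). So there is no filter strictly between, which is strong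
  coatomicity.
  
  The points of the geometry are the filters that are maximal among those avoiding some element.
  By Zorn's lemma every filter is the intersection of the points containing it, so filters
  correspond to closed sets of points. The anti-exchange property says that \<open>A \<inter> P = A \<inter> Q\<close>
  implies \<open>P = Q\<close> for points \<open>P, Q\<close> not containing the filter \<open>A\<close>. If \<open>Q\<close> were not contained in
  \<open>P\<close>, the filter \<open>R\<close> generated by \<open>P\<close> and \<open>Q\<close> would be strictly larger than \<open>P\<close>. Take \<open>f \<in> A - P\<close>
  with an upper cover in \<open>P\<close>. As \<open>P\<close> is a point, \<open>R\<close> meets the filter generated by \<open>P\<close> and \<open>f\<close>
  outside \<open>P\<close>, so \<open>f \<in> R\<close> by the minimality above. But the inclusion defining \<open>SD_join n\<close> carries
  over to filters in the form of join semidistributivity: \<open>A \<inter> P = A \<inter> Q\<close> implies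
  \<open>A \<inter> R \<subseteq> P\<close> (\<open>SD_join_filters\<close>). Hence \<open>f \<in> P\<close>, a contradiction.
\<close>

section \<open>Filters of a lattice\<close>

lemma Fil_le [simp]: "F \<sqsubseteq>\<^bsub>Fil L\<^esub> G \<longleftrightarrow> G \<subseteq> F"
  by (simp add: Fil_def)

lemma Fil_eq [simp]: "F .=\<^bsub>Fil L\<^esub> G \<longleftrightarrow> F = G"
  by (simp add: Fil_def)

lemma Fil_less: "F \<sqsubset>\<^bsub>Fil L\<^esub> G \<longleftrightarrow> G \<subset> F"
  by (auto simp: lless_def)

lemma Fil_partial_order: "partial_order (Fil L)"
  by unfold_locales (auto simp: Fil_def)

lemma FilI:
  assumes "F \<subseteq> carrier L" "F \<noteq> {}"
    and "\<And>x y. x \<in> F \<Longrightarrow> y \<in> carrier L \<Longrightarrow> x \<sqsubseteq>\<^bsub>L\<^esub> y \<Longrightarrow> y \<in> F"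
    and "\<And>x y. x \<in> F \<Longrightarrow> y \<in> F \<Longrightarrow> x \<sqinter>\<^bsub>L\<^esub> y \<in> F"
  shows "F \<in> carrier (Fil L)"
  using assms by (auto simp: Fil_def is_filter_def)

lemma Fil_subset: "F \<in> carrier (Fil L) \<Longrightarrow> F \<subseteq> carrier L"
  by (simp add: Fil_def is_filter_def)

lemma Fil_mem: "F \<in> carrier (Fil L) \<Longrightarrow> x \<in> F \<Longrightarrow> x \<in> carrier L"
  using Fil_subset by blast

lemma Fil_nonempty: "F \<in> carrier (Fil L) \<Longrightarrow> F \<noteq> {}"
  by (simp add: Fil_def)

lemma Fil_up: "F \<in> carrier (Fil L) \<Longrightarrow> x \<in> F \<Longrightarrow> y \<in> carrier L \<Longrightarrow> x \<sqsubseteq>\<^bsub>L\<^esub> y \<Longrightarrow> y \<in> F"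
  by (auto simp: Fil_def is_filter_def)

lemma Fil_meet: "F \<in> carrier (Fil L) \<Longrightarrow> x \<in> F \<Longrightarrow> y \<in> F \<Longrightarrow> x \<sqinter>\<^bsub>L\<^esub> y \<in> F"
  by (auto simp: Fil_def is_filter_def)

lemma Fil_Union_directed:
  assumes "\<D> \<subseteq> carrier (Fil L)" "\<D> \<noteq> {}"
    and "\<And>F G. F \<in> \<D> \<Longrightarrow> G \<in> \<D> \<Longrightarrow> \<exists>H\<in>\<D>. F \<subseteq> H \<and> G \<subseteq> H"
  shows "\<Union>\<D> \<in> carrier (Fil L)"
proof (rule FilI)
  show "\<Union>\<D> \<subseteq> carrier L" using assms(1) by (auto dest: Fil_mem)
  show "\<Union>\<D> \<noteq> {}" using assms(1,2) by (auto dest: Fil_nonempty)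
  show "y \<in> \<Union>\<D>" if "x \<in> \<Union>\<D>" "y \<in> carrier L" "x \<sqsubseteq>\<^bsub>L\<^esub> y" for x y
    using that assms(1) by (meson Fil_up Union_iff subsetD)
  show "x \<sqinter>\<^bsub>L\<^esub> y \<in> \<Union>\<D>" if xy: "x \<in> \<Union>\<D>" "y \<in> \<Union>\<D>" for x y
  proof -
    obtain H where "H \<in> \<D>" "x \<in> H" "y \<in> H" using xy assms(3) by blast
    then show ?thesis using assms(1) by (meson Fil_meet Union_iff subsetD)
  qed
qed

text \<open>
  For filters this is the meet in \<open>Fil L\<close>, that is, the filter generated by the union.
\<close>

definition filter_meet :: "('a, 'b) gorder_scheme \<Rightarrow> 'a set \<Rightarrow> 'a set \<Rightarrow> 'a set"
  where "filter_meet L F G = {z \<in> carrier L. \<exists>p\<in>F. \<exists>q\<in>G. p \<sqinter>\<^bsub>L\<^esub> q \<sqsubseteq>\<^bsub>L\<^esub> z}"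

lemma filter_meet_least:
  assumes "H \<in> carrier (Fil L)" "F \<subseteq> H" "G \<subseteq> H"
  shows "filter_meet L F G \<subseteq> H"
proof
  fix z assume "z \<in> filter_meet L F G"
  then obtain p q where "z \<in> carrier L" "p \<in> H" "q \<in> H" "p \<sqinter>\<^bsub>L\<^esub> q \<sqsubseteq>\<^bsub>L\<^esub> z"
    using assms(2,3) by (auto simp: filter_meet_def)
  then show "z \<in> H" using Fil_up[OF assms(1) Fil_meet[OF assms(1)]] by blast
qed

context lattice
begin

lemma meet_mono:
  assumes "a \<sqsubseteq> b" "c \<sqsubseteq> d" "a \<in> carrier L" "b \<in> carrier L" "c \<in> carrier L" "d \<in> carrier L"
  shows "a \<sqinter> c \<sqsubseteq> b \<sqinter> d"
proof (rule meet_le)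
  show "a \<sqinter> c \<sqsubseteq> b" using le_trans[OF meet_left assms(1)] assms by simp
  show "a \<sqinter> c \<sqsubseteq> d" using le_trans[OF meet_right assms(2)] assms by simp
qed (use assms in auto)

lemma fil_in_Fil:
  assumes "x \<in> carrier L"
  shows "fil L x \<in> carrier (Fil L)"
proof (rule FilI)
  show "fil L x \<subseteq> carrier L" "fil L x \<noteq> {}" using assms by (auto simp: fil_def)
  show "z \<in> fil L x" if "y \<in> fil L x" "z \<in> carrier L" "y \<sqsubseteq> z" for y z
    using that assms le_trans[of x y z] by (simp add: fil_def)
  show "y \<sqinter> z \<in> fil L x" if "y \<in> fil L x" "z \<in> fil L x" for y z
    using that assms meet_le by (simp add: fil_def)
qed

lemma filter_meet_upper1:
  assumes "F \<in> carrier (Fil L)" "G \<in> carrier (Fil L)"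
  shows "F \<subseteq> filter_meet L F G"
proof
  fix x assume x: "x \<in> F"
  obtain q where q: "q \<in> G" using Fil_nonempty[OF assms(2)] by blast
  then show "x \<in> filter_meet L F G"
    using x meet_left[OF Fil_mem[OF assms(1) x] Fil_mem[OF assms(2) q]] Fil_mem[OF assms(1)]
    unfolding filter_meet_def by blast
qed

lemma filter_meet_upper2:
  assumes "F \<in> carrier (Fil L)" "G \<in> carrier (Fil L)"
  shows "G \<subseteq> filter_meet L F G"
proof
  fix x assume x: "x \<in> G"
  obtain q where q: "q \<in> F" using Fil_nonempty[OF assms(1)] by blast
  then show "x \<in> filter_meet L F G"
    using x meet_right[OF Fil_mem[OF assms(1) q] Fil_mem[OF assms(2) x]] Fil_mem[OF assms(2)]
    unfolding filter_meet_def by blast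
qed

lemma filter_meet_in_Fil:
  assumes F: "F \<in> carrier (Fil L)" and G: "G \<in> carrier (Fil L)"
  shows "filter_meet L F G \<in> carrier (Fil L)"
proof (rule FilI)
  show "filter_meet L F G \<subseteq> carrier L" by (auto simp: filter_meet_def)
  show "filter_meet L F G \<noteq> {}" using filter_meet_upper1[OF F G] Fil_nonempty[OF F] by blast
  show "y \<in> filter_meet L F G" if x: "x \<in> filter_meet L F G" and y: "y \<in> carrier L" "x \<sqsubseteq> y" for x y
  proof -
    obtain p q where "p \<in> F" "q \<in> G" "p \<sqinter> q \<sqsubseteq> x" "x \<in> carrier L"
      using x by (auto simp: filter_meet_def)
    moreover from this have "p \<sqinter> q \<sqsubseteq> y"
      using le_trans[OF _ y(2)] y(1) Fil_mem[OF F] Fil_mem[OF G] by simp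
    ultimately show ?thesis using y unfolding filter_meet_def by blast
  qed
  show "x \<sqinter> y \<in> filter_meet L F G"
    if x: "x \<in> filter_meet L F G" and y: "y \<in> filter_meet L F G" for x y
  proof -
    obtain p q where x': "p \<in> F" "q \<in> G" "p \<sqinter> q \<sqsubseteq> x" "x \<in> carrier L"
      using x by (auto simp: filter_meet_def)
    obtain r s where y': "r \<in> F" "s \<in> G" "r \<sqinter> s \<sqsubseteq> y" "y \<in> carrier L"
      using y by (auto simp: filter_meet_def)
    have c: "p \<in> carrier L" "r \<in> carrier L" "q \<in> carrier L" "s \<in> carrier L"
      using x' y' Fil_mem[OF F] Fil_mem[OF G] by auto
    have "(p \<sqinter> r) \<sqinter> (q \<sqinter> s) \<sqsubseteq> p \<sqinter> q" "(p \<sqinter> r) \<sqinter> (q \<sqinter> s) \<sqsubseteq> r \<sqinter> s"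
      using c by (auto intro!: meet_mono meet_left meet_right)
    then have "(p \<sqinter> r) \<sqinter> (q \<sqinter> s) \<sqsubseteq> x" "(p \<sqinter> r) \<sqinter> (q \<sqinter> s) \<sqsubseteq> y"
      using c x' y' le_trans[OF _ x'(3)] le_trans[OF _ y'(3)] by simp_all
    then have "(p \<sqinter> r) \<sqinter> (q \<sqinter> s) \<sqsubseteq> x \<sqinter> y" using c x' y' by (intro meet_le) auto
    moreover have "p \<sqinter> r \<in> F" "q \<sqinter> s \<in> G" using Fil_meet[OF F] Fil_meet[OF G] x' y' by auto
    ultimately show ?thesis using c x'(4) y'(4) unfolding filter_meet_def by auto
  qed
qed


section \<open>Join semidistributivity passes to filters\<close>

text \<open>
  Let \<open>x \<in> A\<close> lie above \<open>p \<sqinter> q\<close> with \<open>p \<in> P\<close> and \<open>q \<in> Q\<close>. All the terms \<open>y_term L k x p q\<close>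
  stay in \<open>P\<close> and all the terms \<open>z_term L k x p q\<close> stay in \<open>Q\<close>, while the \<open>n\<close>-th
  \<open>y\<close>-term lies below \<open>x \<squnion> (p \<sqinter> q) = x\<close>. Working with elements in this way avoids
  verifying the inclusion itself in the lattice of filters.
\<close>

lemma SD_join_filters:
  assumes SD: "SD_join n L"
    and F: "A \<in> carrier (Fil L)" "P \<in> carrier (Fil L)" "Q \<in> carrier (Fil L)"
    and eq: "A \<inter> P = A \<inter> Q"
  shows "A \<inter> filter_meet L P Q \<subseteq> P"
proof
  fix x assume "x \<in> A \<inter> filter_meet L P Q"
  then obtain p q where x: "x \<in> A" "x \<in> carrier L" and pq: "p \<in> P" "q \<in> Q" "p \<sqinter> q \<sqsubseteq> x"
    unfolding filter_meet_def by blast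
  have c: "p \<in> carrier L" "q \<in> carrier L" using pq Fil_mem[OF F(2)] Fil_mem[OF F(3)] by auto
  have join_mem: "x \<squnion> u \<in> A \<inter> H" if "H \<in> carrier (Fil L)" "u \<in> H" for u H
  proof -
    have u: "u \<in> carrier L" using Fil_mem[OF that] .
    show ?thesis
      using Fil_up[OF F(1) x(1) _ join_left[OF x(2) u]] Fil_up[OF that _ join_right[OF x(2) u]] x u
      by simp
  qed
  \<comment> \<open>Each join with \<open>x\<close> lands in \<open>A\<close>, where \<open>P\<close> and \<open>Q\<close> cannot be told apart.\<close>
  have "y_term L k x p q \<in> P \<and> z_term L k x p q \<in> Q" for k
  proof (induction k)
    case (Suc k)
    then have "x \<squnion> z_term L k x p q \<in> P" "x \<squnion> y_term L k x p q \<in> Q"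
      using join_mem[OF F(2)] join_mem[OF F(3)] eq by blast+
    then show ?case using Fil_meet[OF F(2) pq(1)] Fil_meet[OF F(3) pq(2)] by simp
  qed (use pq in simp)
  then have y: "y_term L n x p q \<in> P" by blast
  have "y_term L n x p q \<sqsubseteq> x \<squnion> (p \<sqinter> q)" using SD x c by (auto simp: SD_join_def)
  moreover have "x \<squnion> (p \<sqinter> q) = x"
    using le_iff_meet[of "p \<sqinter> q" x] x c pq by (simp add: join_comm)
  ultimately show "x \<in> P" using Fil_up[OF F(2) y x(2)] by simp
qed


section \<open>Lower semimodularity and covers of filters\<close>

lemma between_cover:
  assumes "covered_by L a b" "k \<in> carrier L" "a \<sqsubseteq> k" "k \<sqsubseteq> b"
  shows "k = a \<or> k = b"
  using assms eq_is_equal by (auto simp: covered_by_def lless_def)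

text \<open>
  An element \<open>h \<in> H - F\<close> lies above some \<open>f \<sqinter> a\<close> with \<open>a \<in> F\<close>. Meeting \<open>h\<close> with
  \<open>g \<sqinter> a \<in> F\<close> gives an element of \<open>H\<close> squeezed into the cover \<open>f \<sqinter> a \<prec> g \<sqinter> a\<close>. It cannot be
  the upper end, since otherwise \<open>h \<in> F\<close>; so it is the lower end, which lies below \<open>f\<close>.
\<close>

lemma adjoin_lower_cover_minimal:
  assumes LSM: "lower_semimodular L"
    and F: "F \<in> carrier (Fil L)" "H \<in> carrier (Fil L)"
    and fg: "covered_by L f g" "g \<in> F" "f \<notin> F"
    and H: "F \<subset> H" "H \<subseteq> filter_meet L F (fil L f)"
  shows "f \<in> H"
proof -
  obtain h where h: "h \<in> H" "h \<notin> F" using H(1) by blast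
  have f: "f \<in> carrier L" using fg(1) by (simp add: covered_by_def)
  obtain a r where a: "a \<in> F" and r: "r \<in> carrier L" "f \<sqsubseteq> r" and ar: "a \<sqinter> r \<sqsubseteq> h"
    using h(1) H(2) by (auto simp: filter_meet_def fil_def)
  have c: "f \<in> carrier L" "g \<in> carrier L" "a \<in> carrier L" "h \<in> carrier L"
    using f fg(2) a h(1) Fil_mem[OF F(1)] Fil_mem[OF F(2)] by auto
  have "f \<sqinter> a \<sqsubseteq> a \<sqinter> r" using meet_mono[OF r(2) le_refl] c r by (simp add: meet_comm)
  then have fa: "f \<sqinter> a \<sqsubseteq> h" using le_trans[OF _ ar] c r by simp
  have fg_le: "f \<sqsubseteq> g" using fg(1) by (simp add: covered_by_def lless_def)
  have ga: "g \<sqinter> a \<in> F" by (rule Fil_meet[OF F(1) fg(2) a])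
  \<comment> \<open>Equality in the semimodular law would put \<open>f\<close> into \<open>F\<close>.\<close>
  have "f \<sqinter> a \<noteq> g \<sqinter> a"
    using Fil_up[OF F(1) ga f] fg(3) meet_left[OF f c(3)] by auto
  then have cov: "covered_by L (f \<sqinter> a) (g \<sqinter> a)"
    using LSM fg(1) c by (auto simp: lower_semimodular_def)
  let ?k = "h \<sqinter> (g \<sqinter> a)"
  have k: "?k \<in> H" using Fil_meet[OF F(2) h(1)] ga H(1) by blast
  have "f \<sqinter> a \<sqsubseteq> g \<sqinter> a" using meet_mono[OF fg_le le_refl] c by simp
  then have "f \<sqinter> a \<sqsubseteq> ?k" using meet_le fa c by simp
  moreover have "?k \<sqsubseteq> g \<sqinter> a" using meet_right c by simp
  ultimately have "?k = f \<sqinter> a \<or> ?k = g \<sqinter> a" using between_cover[OF cov] c by simp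
  moreover have "?k \<noteq> g \<sqinter> a"
    using Fil_up[OF F(1) ga c(4)] h(2) meet_left[of h "g \<sqinter> a"] c by auto
  ultimately show "f \<in> H" using Fil_up[OF F(2) k f] meet_left[OF f c(3)] by simp
qed

end


section \<open>Finite principal filters\<close>

locale upper_finite_lattice = lattice +
  assumes carrier_nonempty: "carrier L \<noteq> {}"
    and finite_fil: "x \<in> carrier L \<Longrightarrow> finite (fil L x)"
begin

lemma fil_psubset:
  assumes "x \<sqsubset> y" "x \<in> carrier L" "y \<in> carrier L"
  shows "fil L y \<subset> fil L x"
proof -
  have le: "x \<sqsubseteq> y" and neq: "x \<noteq> y" using assms(1) eq_is_equal by (auto simp: lless_def)
  have "fil L y \<subseteq> fil L x" using le_trans[OF le] assms by (auto simp: fil_def)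
  moreover have "x \<in> fil L x" "x \<notin> fil L y"
    using assms le neq le_antisym[of x y] by (auto simp: fil_def)
  ultimately show ?thesis by blast
qed

text \<open>
  The set \<open>S\<close> may be infinite: going up strictly decreases the size of the principal filter, so an
  element with a principal filter of least size is maximal.
\<close>

lemma maximal_element:
  assumes "S \<subseteq> carrier L" "S \<noteq> {}"
  obtains m where "m \<in> S" "\<And>y. y \<in> S \<Longrightarrow> \<not> m \<sqsubset> y"
proof -
  obtain m where m: "m \<in> S" "\<And>y. y \<in> S \<Longrightarrow> card (fil L m) \<le> card (fil L y)"
    using ex_has_least_nat[of "\<lambda>x. x \<in> S" _ "\<lambda>x. card (fil L x)"] assms(2) by blast
  have "\<not> m \<sqsubset> y" if "y \<in> S" for y
    using that m assms(1) fil_psubset[of m y] psubset_card_mono[OF finite_fil, of m "fil L y"]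
    by (meson in_mono not_le)
  then show thesis using that m(1) by blast
qed

lemma top_of_filters:
  obtains t where "t \<in> carrier L" "\<And>x. x \<in> carrier L \<Longrightarrow> x \<sqsubseteq> t"
    "\<And>F. F \<in> carrier (Fil L) \<Longrightarrow> t \<in> F"
proof -
  obtain t where t: "t \<in> carrier L" "\<And>y. y \<in> carrier L \<Longrightarrow> \<not> t \<sqsubset> y"
    using maximal_element[OF subset_refl carrier_nonempty] by blast
  have top: "x \<sqsubseteq> t" if x: "x \<in> carrier L" for x
  proof -
    have "t = t \<squnion> x" using t(2)[of "t \<squnion> x"] join_left[OF t(1) x] t(1) x eq_is_equal
      by (auto simp: lless_def)
    then show ?thesis using join_right[OF t(1) x] by simp
  qed
  have "t \<in> F" if F: "F \<in> carrier (Fil L)" for F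
  proof -
    obtain u where u: "u \<in> F" using Fil_nonempty[OF F] by blast
    show ?thesis by (rule Fil_up[OF F u t(1) top[OF Fil_mem[OF F u]]])
  qed
  then show thesis using that t(1) top by blast
qed

lemma upper_cover:
  assumes "x \<in> carrier L" "y \<in> carrier L" "x \<sqsubset> y"
  obtains z where "covered_by L x z"
proof -
  \<comment> \<open>The set \<open>fil L x - fil L z\<close> shrinks as \<open>z\<close> goes down towards \<open>x\<close>, so a least size gives a cover.\<close>
  let ?S = "{z \<in> carrier L. x \<sqsubset> z}"
  obtain z where z: "z \<in> ?S"
    and min: "\<And>w. w \<in> ?S \<Longrightarrow> card (fil L x - fil L z) \<le> card (fil L x - fil L w)"
    using ex_has_least_nat[of "\<lambda>z. z \<in> ?S" y "\<lambda>z. card (fil L x - fil L z)"] assms by blast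
  have False if w: "w \<in> carrier L" "x \<sqsubset> w" "w \<sqsubset> z" for w
  proof -
    have "fil L z \<subset> fil L w" "fil L w \<subset> fil L x"
      using fil_psubset w z assms(1) by simp_all
    then have "fil L x - fil L w \<subset> fil L x - fil L z" by blast
    then have "card (fil L x - fil L w) < card (fil L x - fil L z)"
      using finite_fil[OF assms(1)] psubset_card_mono by blast
    then show False using min[of w] w by simp
  qed
  then show thesis using that z assms(1) by (auto simp: covered_by_def)
qed

text \<open>
  Take \<open>f\<close> maximal in \<open>F - G\<close>. It is not the top element, since that lies in every filter, so it has
  an upper cover \<open>g\<close>, which lies in \<open>F\<close> and hence by maximality in \<open>G\<close>.
\<close>

lemma critical_element:
  assumes F: "F \<in> carrier (Fil L)" "G \<in> carrier (Fil L)" and "\<not> F \<subseteq> G"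
  obtains f g where "f \<in> F" "f \<notin> G" "g \<in> G" "covered_by L f g"
proof -
  have "F - G \<subseteq> carrier L" "F - G \<noteq> {}" using assms Fil_subset[OF F(1)] by auto
  then obtain f where f: "f \<in> F - G" and max: "\<And>y. y \<in> F - G \<Longrightarrow> \<not> f \<sqsubset> y"
    using maximal_element by blast
  have fc: "f \<in> carrier L" using f Fil_mem[OF F(1)] by blast
  obtain t where t: "t \<in> carrier L" "f \<sqsubseteq> t" "t \<in> G" using top_of_filters F(2) fc by metis
  then have "f \<sqsubset> t" using f eq_is_equal by (auto simp: lless_def)
  then obtain g where g: "covered_by L f g" using upper_cover fc t(1) by blast
  then have g': "g \<in> carrier L" "f \<sqsubset> g" by (auto simp: covered_by_def)
  then have "g \<in> F" using Fil_up[OF F(1) _ g'(1), of f] f by (simp add: lless_def)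
  then show thesis using that f g g' max by blast
qed


section \<open>The lattice of filters\<close>

text \<open>
  The intersection with the carrier matters only for the empty family, whose intersection would
  otherwise be the whole type. Nonemptiness is due to the top element.
\<close>

lemma Inter_in_Fil:
  assumes "\<S> \<subseteq> carrier (Fil L)"
  shows "carrier L \<inter> \<Inter>\<S> \<in> carrier (Fil L)"
proof (rule FilI)
  obtain t where t: "t \<in> carrier L" "\<And>F. F \<in> carrier (Fil L) \<Longrightarrow> t \<in> F"
    using top_of_filters by metis
  from t show "carrier L \<inter> \<Inter>\<S> \<noteq> {}" using assms by blast
  show "y \<in> carrier L \<inter> \<Inter>\<S>" if "x \<in> carrier L \<inter> \<Inter>\<S>" "y \<in> carrier L" "x \<sqsubseteq> y" for x y
    using that assms by (auto intro: Fil_up)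
  show "x \<sqinter> y \<in> carrier L \<inter> \<Inter>\<S>" if "x \<in> carrier L \<inter> \<Inter>\<S>" "y \<in> carrier L \<inter> \<Inter>\<S>" for x y
    using that assms by (auto intro: Fil_meet)
qed simp

lemma Int_in_Fil:
  assumes "F \<in> carrier (Fil L)" "G \<in> carrier (Fil L)"
  shows "F \<inter> G \<in> carrier (Fil L)"
proof -
  have "F \<inter> G = carrier L \<inter> \<Inter>{F, G}" using Fil_subset[OF assms(1)] by blast
  then show ?thesis using Inter_in_Fil[of "{F, G}"] assms by auto
qed

lemma Fil_complete_lattice: "complete_lattice (Fil L)"
proof (rule partial_order.complete_latticeI[OF Fil_partial_order])
  fix \<S> assume S: "\<S> \<subseteq> carrier (Fil L)"
  have "least (Fil L) (carrier L \<inter> \<Inter>\<S>) (Upper (Fil L) \<S>)"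
  proof (rule least_UpperI)
    show "F \<sqsubseteq>\<^bsub>Fil L\<^esub> carrier L \<inter> \<Inter>\<S>" if "F \<in> \<S>" for F using that by auto
    show "carrier L \<inter> \<Inter>\<S> \<sqsubseteq>\<^bsub>Fil L\<^esub> G" if "G \<in> Upper (Fil L) \<S>" for G
      using that S Fil_subset[of G L] by (auto simp: Upper_def)
    show "carrier L \<inter> \<Inter>\<S> \<in> carrier (Fil L)" by (rule Inter_in_Fil[OF S])
  qed (rule S)
  then show "\<exists>s. least (Fil L) s (Upper (Fil L) \<S>)" by blast
  let ?\<T> = "{G \<in> carrier (Fil L). \<Union>\<S> \<subseteq> G}"
  have "greatest (Fil L) (carrier L \<inter> \<Inter>?\<T>) (Lower (Fil L) \<S>)"
  proof (rule greatest_LowerI)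
    show "carrier L \<inter> \<Inter>?\<T> \<sqsubseteq>\<^bsub>Fil L\<^esub> F" if "F \<in> \<S>" for F
      using that S Fil_subset[of F L] by auto
    show "G \<sqsubseteq>\<^bsub>Fil L\<^esub> carrier L \<inter> \<Inter>?\<T>" if "G \<in> Lower (Fil L) \<S>" for G
    proof -
      have "G \<in> ?\<T>" using that S by (auto simp: Lower_def)
      then show ?thesis by auto
    qed
    show "carrier L \<inter> \<Inter>?\<T> \<in> carrier (Fil L)" by (rule Inter_in_Fil) blast
  qed (rule S)
  then show "\<exists>i. greatest (Fil L) i (Lower (Fil L) \<S>)" by blast
qed

sublocale Fil: complete_lattice "Fil L"
  by (rule Fil_complete_lattice)

lemma Fil_join:
  assumes F: "F \<in> carrier (Fil L)" "G \<in> carrier (Fil L)"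
  shows "F \<squnion>\<^bsub>Fil L\<^esub> G = F \<inter> G"
proof
  show "F \<squnion>\<^bsub>Fil L\<^esub> G \<subseteq> F \<inter> G" using Fil.join_left[OF F] Fil.join_right[OF F] by simp
  show "F \<inter> G \<subseteq> F \<squnion>\<^bsub>Fil L\<^esub> G"
    using Fil.join_le[OF _ _ F Int_in_Fil[OF F]] by simp
qed

lemma Fil_inf_directed:
  assumes D: "down_directed (Fil L) \<D>"
  shows "\<Sqinter>\<^bsub>Fil L\<^esub> \<D> = \<Union>\<D>"
proof -
  have "\<Union>\<D> \<in> carrier (Fil L)"
    using D by (intro Fil_Union_directed) (auto simp: down_directed_def)
  then have glb: "greatest (Fil L) (\<Union>\<D>) (Lower (Fil L) \<D>)"
    using D by (intro greatest_LowerI) (auto simp: down_directed_def Lower_def)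
  show ?thesis
    unfolding inf_def
    by (rule some_equality[where P = "\<lambda>G. greatest (Fil L) G (Lower (Fil L) \<D>)", OF glb])
      (rule Fil.greatest_unique[OF _ glb])
qed

lemma Fil_lower_continuous: "lower_continuous (Fil L)"
  unfolding lower_continuous_def
proof (intro conjI ballI allI impI Fil_complete_lattice)
  fix A \<D> assume A: "A \<in> carrier (Fil L)" and D: "down_directed (Fil L) \<D>"
  have U: "\<Union>\<D> \<in> carrier (Fil L)"
    using D by (intro Fil_Union_directed) (auto simp: down_directed_def)
  have img: "(\<lambda>d. A \<squnion>\<^bsub>Fil L\<^esub> d) ` \<D> = (\<lambda>d. A \<inter> d) ` \<D>"
    using Fil_join[OF A] D by (intro image_cong) (auto simp: down_directed_def)
  have dir: "down_directed (Fil L) ((\<lambda>d. A \<inter> d) ` \<D>)"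
    unfolding down_directed_def
  proof (intro conjI ballI)
    show "(\<lambda>d. A \<inter> d) ` \<D> \<subseteq> carrier (Fil L)"
      using D Int_in_Fil[OF A] by (auto simp: down_directed_def)
    show "(\<lambda>d. A \<inter> d) ` \<D> \<noteq> {}" using D by (simp add: down_directed_def)
    fix F G assume "F \<in> (\<lambda>d. A \<inter> d) ` \<D>" "G \<in> (\<lambda>d. A \<inter> d) ` \<D>"
    then obtain c d where cd: "c \<in> \<D>" "F = A \<inter> c" "d \<in> \<D>" "G = A \<inter> d" by blast
    then obtain e where "e \<in> \<D>" "c \<subseteq> e" "d \<subseteq> e"
      using D unfolding down_directed_def Fil_le by meson
    then show "\<exists>H\<in>(\<lambda>d. A \<inter> d) ` \<D>. H \<sqsubseteq>\<^bsub>Fil L\<^esub> F \<and> H \<sqsubseteq>\<^bsub>Fil L\<^esub> G"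
      using cd by auto
  qed
  have "A \<squnion>\<^bsub>Fil L\<^esub> \<Sqinter>\<^bsub>Fil L\<^esub> \<D> = A \<inter> \<Union>\<D>"
    by (simp only: Fil_inf_directed[OF D] Fil_join[OF A U])
  also have "\<dots> = \<Union>((\<lambda>d. A \<inter> d) ` \<D>)" by blast
  also have "\<dots> = \<Sqinter>\<^bsub>Fil L\<^esub> ((\<lambda>d. A \<squnion>\<^bsub>Fil L\<^esub> d) ` \<D>)"
    by (simp only: img Fil_inf_directed[OF dir])
  finally show "A \<squnion>\<^bsub>Fil L\<^esub> \<Sqinter>\<^bsub>Fil L\<^esub> \<D> = \<Sqinter>\<^bsub>Fil L\<^esub> ((\<lambda>d. A \<squnion>\<^bsub>Fil L\<^esub> d) ` \<D>)" .
qed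

text \<open>
  The lower cover of \<open>G\<close> is the filter generated by \<open>G\<close> together with an element \<open>f\<close> just below it.
\<close>

lemma Fil_strongly_coatomic:
  assumes LSM: "lower_semimodular L"
  shows "strongly_coatomic (Fil L)"
  unfolding strongly_coatomic_def
proof (intro conjI ballI impI)
  show "lattice (Fil L)" using Fil_complete_lattice by simp
  fix F G assume F: "F \<in> carrier (Fil L)" and G: "G \<in> carrier (Fil L)" and "F \<sqsubset>\<^bsub>Fil L\<^esub> G"
  then have GF: "G \<subset> F" by (simp add: Fil_less)
  then have "\<not> F \<subseteq> G" by blast
  with F G obtain f g where fg: "f \<in> F" "f \<notin> G" "g \<in> G" "covered_by L f g"
    by (rule critical_element)
  let ?B = "filter_meet L G (fil L f)"
  have f: "f \<in> carrier L" by (rule Fil_mem[OF F fg(1)])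
  note filf = fil_in_Fil[OF f]
  have B: "?B \<in> carrier (Fil L)" by (rule filter_meet_in_Fil[OF G filf])
  have "fil L f \<subseteq> F" using Fil_up[OF F fg(1)] unfolding fil_def by blast
  then have BF: "?B \<subseteq> F" using filter_meet_least[OF F] GF by blast
  have "f \<in> ?B" using filter_meet_upper2[OF G filf] f by (auto simp: fil_def)
  then have GB: "G \<subset> ?B" using filter_meet_upper1[OF G filf] fg(2) by blast
  have "\<not> H \<subset> ?B" if H: "H \<in> carrier (Fil L)" "G \<subset> H" for H
  proof
    assume HB: "H \<subset> ?B"
    then have "f \<in> H"
      using adjoin_lower_cover_minimal[OF LSM G H(1) fg(4,3,2) H(2)] by blast
    then have "fil L f \<subseteq> H" using Fil_up[OF H(1), of f] unfolding fil_def by blast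
    then show False using filter_meet_least[OF H(1)] H(2) HB by blast
  qed
  then have "covered_by (Fil L) ?B G" using B G GB by (auto simp: covered_by_def Fil_less)
  then show "\<exists>B\<in>carrier (Fil L). F \<sqsubseteq>\<^bsub>Fil L\<^esub> B \<and> covered_by (Fil L) B G"
    using B BF by auto
qed


section \<open>The convex geometry of relatively maximal filters\<close>

definition maximal_avoiding :: "'a \<Rightarrow> 'a set \<Rightarrow> bool"
  where "maximal_avoiding x P \<longleftrightarrow> P \<in> carrier (Fil L) \<and> x \<in> carrier L \<and> x \<notin> P \<and>
    (\<forall>H\<in>carrier (Fil L). P \<subset> H \<longrightarrow> x \<in> H)"

text \<open>
  In \<open>Fil L\<close> these are the completely join irreducible elements.
\<close>

definition points :: "'a set set"
  where "points = {P. \<exists>x. maximal_avoiding x P}"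

lemma points_in_Fil: "P \<in> points \<Longrightarrow> P \<in> carrier (Fil L)"
  by (auto simp: points_def maximal_avoiding_def)

lemma separating_point:
  assumes F: "F \<in> carrier (Fil L)" and x: "x \<in> carrier L" "x \<notin> F"
  obtains P where "P \<in> points" "F \<subseteq> P" "x \<notin> P"
proof -
  let ?A = "{H \<in> carrier (Fil L). F \<subseteq> H \<and> x \<notin> H}"
  have "\<exists>M\<in>?A. \<forall>X\<in>?A. M \<subseteq> X \<longrightarrow> X = M"
  proof (rule subset_Zorn_nonempty)
    show "?A \<noteq> {}" using F x by blast
    fix \<C> assume ne: "\<C> \<noteq> {}" and "subset.chain ?A \<C>"
    then have C: "\<C> \<subseteq> ?A" "\<And>X Y. X \<in> \<C> \<Longrightarrow> Y \<in> \<C> \<Longrightarrow> X \<subseteq> Y \<or> Y \<subseteq> X"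
      by (auto simp: subset_chain_def)
    have "\<Union>\<C> \<in> carrier (Fil L)"
    proof (rule Fil_Union_directed[OF _ ne])
      show "\<C> \<subseteq> carrier (Fil L)" using C(1) by blast
      show "\<exists>Z\<in>\<C>. X \<subseteq> Z \<and> Y \<subseteq> Z" if "X \<in> \<C>" "Y \<in> \<C>" for X Y
        using C(2)[OF that] that by blast
    qed
    then show "\<Union>\<C> \<in> ?A" using C(1) ne by blast
  qed
  then obtain P where P: "P \<in> ?A" and max: "\<forall>X\<in>?A. P \<subseteq> X \<longrightarrow> X = P" by (rule bexE)
  have "x \<in> H" if H: "H \<in> carrier (Fil L)" "P \<subset> H" for H
    using max P H by blast
  moreover have "P \<in> carrier (Fil L)" "x \<notin> P" using P by simp_all
  ultimately have "maximal_avoiding x P" using x(1) by (simp add: maximal_avoiding_def)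
  then show thesis using that[of P] P by (auto simp: points_def)
qed

text \<open>
  Applied in both directions to points \<open>P\<close> and \<open>Q\<close>, this gives the anti-exchange property. Above the
  point \<open>P\<close> no two strictly larger filters intersect in \<open>P\<close>; this is used for the filter generated
  by \<open>P\<close> and \<open>Q\<close> and the one generated by \<open>P\<close> and an element \<open>f \<in> A\<close> just below \<open>P\<close>.
\<close>

lemma equal_joins_with_point:
  assumes LSM: "lower_semimodular L" and SD: "SD_join n L"
    and A: "A \<in> carrier (Fil L)" and Q: "Q \<in> carrier (Fil L)" and P: "P \<in> points"
    and eq: "A \<inter> P = A \<inter> Q" and nsub: "\<not> A \<subseteq> P"
  shows "Q \<subseteq> P"
proof (rule ccontr)
  assume QP: "\<not> Q \<subseteq> P"
  obtain x where x: "maximal_avoiding x P" using P by (auto simp: points_def)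
  have PF: "P \<in> carrier (Fil L)" by (rule points_in_Fil[OF P])
  let ?R = "filter_meet L P Q"
  have R: "?R \<in> carrier (Fil L)" "P \<subset> ?R"
    using filter_meet_in_Fil[OF PF Q] filter_meet_upper1[OF PF Q] filter_meet_upper2[OF PF Q] QP
    by blast+
  obtain f g where fg: "f \<in> A" "f \<notin> P" "g \<in> P" "covered_by L f g"
    by (rule critical_element[OF A PF nsub])
  let ?C = "filter_meet L P (fil L f)"
  have f: "f \<in> carrier L" by (rule Fil_mem[OF A fg(1)])
  note filf = fil_in_Fil[OF f]
  have "f \<in> ?C" using filter_meet_upper2[OF PF filf] f by (auto simp: fil_def)
  then have C: "?C \<in> carrier (Fil L)" "P \<subset> ?C"
    using filter_meet_in_Fil[OF PF filf] filter_meet_upper1[OF PF filf] fg(2) by blast+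
  \<comment> \<open>Both filters properly contain \<open>P\<close>, hence contain \<open>x\<close>, so their intersection is still larger.\<close>
  have "x \<in> ?R \<inter> ?C" "x \<notin> P" using x R C by (auto simp: maximal_avoiding_def)
  then have "P \<subset> ?R \<inter> ?C" using R(2) C(2) by blast
  then have "f \<in> ?R \<inter> ?C"
    using adjoin_lower_cover_minimal[OF LSM PF Int_in_Fil[OF R(1) C(1)] fg(4,3,2)] by blast
  then have "f \<in> P" using SD_join_filters[OF SD A PF Q eq] fg(1) by blast
  then show False using fg(2) by blast
qed

definition point_closure :: "'a set set \<Rightarrow> 'a set set"
  where "point_closure \<A> = {P \<in> points. carrier L \<inter> \<Inter>\<A> \<subseteq> P}"

lemma point_closure_convex_geometry:
  assumes LSM: "lower_semimodular L" and SD: "SD_join n L"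
  shows "convex_geometry points point_closure"
proof
  show "point_closure \<A> \<subseteq> points" for \<A> by (auto simp: point_closure_def)
  show "\<A> \<subseteq> point_closure \<A>" if "\<A> \<subseteq> points" for \<A> using that by (auto simp: point_closure_def)
  show "point_closure \<A> \<subseteq> point_closure \<B>" if "\<A> \<subseteq> \<B>" for \<A> \<B> using that by (auto simp: point_closure_def)
  show "point_closure (point_closure \<A>) = point_closure \<A>" if "\<A> \<subseteq> points" for \<A> using that by (auto simp: point_closure_def)
  show "point_closure {} = {}"
    by (auto simp: point_closure_def points_def maximal_avoiding_def)
next
  fix P Q \<A>
  assume P: "P \<in> points" and Q: "Q \<in> points" and neq: "P \<noteq> Q"
    and \<A>: "\<A> \<in> closed_sets points point_closure" and PQ: "P \<in> point_closure (\<A> \<union> {Q})" and notin: "P \<notin> \<A>"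
  let ?A = "carrier L \<inter> \<Inter>\<A>"
  have "\<A> \<subseteq> points" "point_closure \<A> = \<A>" using \<A> by (auto simp: closed_sets_def)
  then have A: "?A \<in> carrier (Fil L)" and nsub: "\<not> ?A \<subseteq> P"
    using Inter_in_Fil[of \<A>] points_in_Fil P notin by (blast, auto simp: point_closure_def)
  show "Q \<notin> point_closure (\<A> \<union> {P})"
  proof
    assume "Q \<in> point_closure (\<A> \<union> {P})"
    then have eq: "?A \<inter> P = ?A \<inter> Q" using PQ by (auto simp: point_closure_def)
    then have "\<not> ?A \<subseteq> Q" using nsub by blast
    then have "Q \<subseteq> P" "P \<subseteq> Q"
      using equal_joins_with_point[OF LSM SD A] points_in_Fil P Q eq nsub by metis+
    then show False using neq by blast
  qed
qed

text \<open>
  A filter corresponds to the set of points above it in \<open>Fil L\<close>; this determines the filter because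
  points separate a filter from each element outside it.
\<close>

lemma Fil_iso_closed_sets: "order_isomorphic (Fil L) (closed_set_lattice points point_closure)"
proof -
  define above where "above F = {P \<in> points. F \<subseteq> P}" for F
  have above_le: "above F \<subseteq> above G \<longleftrightarrow> G \<subseteq> F"
    if F: "F \<in> carrier (Fil L)" "G \<in> carrier (Fil L)" for F G
  proof
    assume sub: "above F \<subseteq> above G"
    show "G \<subseteq> F"
    proof (rule subsetI, rule ccontr)
      fix x assume x: "x \<in> G" "x \<notin> F"
      then have "x \<in> carrier L" using Fil_mem[OF F(2)] by blast
      then obtain P where "P \<in> points" "F \<subseteq> P" "x \<notin> P" using separating_point F(1) x(2) by blast
      then show False using sub x(1) by (auto simp: above_def)
    qed
  qed (auto simp: above_def)
  have "inj_on above (carrier (Fil L))"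
    by (rule inj_onI) (metis above_le order_refl subset_antisym)
  moreover have "above ` carrier (Fil L) = closed_sets points point_closure"
  proof
    show "above ` carrier (Fil L) \<subseteq> closed_sets points point_closure"
    proof (rule image_subsetI)
      fix F assume F: "F \<in> carrier (Fil L)"
      have "F \<subseteq> carrier L \<inter> \<Inter>(above F)" using Fil_subset[OF F] by (auto simp: above_def)
      then show "above F \<in> closed_sets points point_closure"
        by (auto simp: closed_sets_def point_closure_def above_def)
    qed
    show "closed_sets points point_closure \<subseteq> above ` carrier (Fil L)"
    proof
      fix \<A> assume "\<A> \<in> closed_sets points point_closure"
      then have "\<A> \<subseteq> points" "\<A> = above (carrier L \<inter> \<Inter>\<A>)"
        by (auto simp: closed_sets_def point_closure_def above_def)
      then show "\<A> \<in> above ` carrier (Fil L)"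
        using Inter_in_Fil[of \<A>] points_in_Fil by blast
    qed
  qed
  moreover have "order_emb (Fil L) (closed_set_lattice points point_closure) above"
    using above_le Fil_partial_order[THEN partial_order.axioms(1), of L]
      closed_set_lattice_partial_order[THEN partial_order.axioms(1), of points point_closure]
    by (auto simp: order_emb_def closed_set_lattice_def)
  ultimately show ?thesis
    by (auto simp: order_isomorphic_def bij_betw_def closed_set_lattice_def)
qed

end

theorem theorem16:
  fixes L\<^sub>0 :: "('a, 'b) gorder_scheme"
  assumes "lattice L\<^sub>0" and "carrier L\<^sub>0 \<noteq> {}"
    and "\<And>x. x \<in> carrier L\<^sub>0 \<Longrightarrow> finite (fil L\<^sub>0 x)"
    and "\<exists>n. SD_join n L\<^sub>0"
    and "lower_semimodular L\<^sub>0"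
  shows "complete_lattice (Fil L\<^sub>0) \<and> strongly_coatomic (Fil L\<^sub>0) \<and>
    lower_continuous (Fil L\<^sub>0) \<and> is_convex_geometry_lattice (Fil L\<^sub>0)"
proof -
  interpret lattice L\<^sub>0 by fact
  interpret upper_finite_lattice L\<^sub>0 by unfold_locales (use assms in auto)
  obtain n where "SD_join n L\<^sub>0" using assms(4) by blast
  then have "is_convex_geometry_lattice (Fil L\<^sub>0)"
    using point_closure_convex_geometry[OF assms(5)] Fil_iso_closed_sets
    unfolding is_convex_geometry_lattice_def by blast
  then show ?thesis
    using Fil_complete_lattice Fil_strongly_coatomic[OF assms(5)] Fil_lower_continuous by blast
qed

end
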